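(* Let $V \in \mathbb{R}^{d \times n}$ be a matrix of rank $d$, let $Z = Z(V)$ be the zonotope generated by $V$, and let $w, w' \in \mathbb{R}^d$ be vectors such that the matrix $(V|w|w') \in \mathbb{R}^{d\times(n+2)}$ is unimodular. Then $$|Z|\,\bigl|Z+[0,w]+[0,w']\bigr| \leq \bigl|Z+[0,w]\bigr|\,\bigl|Z+[0,w']\bigr|.$$ Moreover, equality holds if and only if $w \perp (VV^T)^{-1}w'$, i.e. $w^T(VV^T)^{-1}w' = 0$.
   Context: For a matrix $V = (v_1,\dots,v_n) \in \mathbb{R}^{d\times n}$ with columns $v_i$, the zonotope generated by $V$ is $Z(V) = \{\sum_{i=1}^n \lambda_i v_i : \lambda_i \in [0,1]\} \subseteq \mathbb{R}^d$, the Minkowski sum of the segments $[0,v_i] = \mathrm{conv}(0,v_i)$. The sign $+$ between sets denotes Minkowski addition, $|\cdot|$ denotes $d$-dimensional volume (Lebesgue measure), and $(V|w|w')$ denotes the matrix $V$ with the columns $w$ and $w'$ appended. A matrix with $d$ rows is called unimodular if all its $(d\times d)$-sub-determinants lie in $\{-1,0,1\}$. *)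

theory Defs
  imports "HOL-Analysis.Analysis" "HOL-Library.Set_Algebras"
begin

definition zonotope :: "real^'n^'d \<Rightarrow> (real^'d) set" where
  "zonotope V = {\<Sum>i\<in>UNIV. c i *\<^sub>R column i V | c :: 'n \<Rightarrow> real. \<forall>i. c i \<in> {0..1}}"

text \<open>The matrix \<open>(A|w)\<close>: its columns are indexed by \<open>'m option\<close>, the new one being column \<open>None\<close>.\<close>

definition append_column :: "'a^'m^'d \<Rightarrow> 'a^'d \<Rightarrow> 'a^'m option^'d" where
  "append_column A w = (\<chi> i j. case j of None \<Rightarrow> w $ i | Some k \<Rightarrow> A $ i $ k)"

text \<open>A maximal square submatrix is given by an injective choice \<open>f\<close> of columns. Listing the
  same columns in another order only changes the sign of the determinant, so the condition
  does not depend on an ordering of the column index type.\<close>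

definition unimodular :: "real^'m^'d \<Rightarrow> bool" where
  "unimodular A \<longleftrightarrow> (\<forall>f :: 'd \<Rightarrow> 'm. inj f \<longrightarrow> det (\<chi> i j. A $ i $ f j) \<in> {-1, 0, 1})"

end

theory Submission
  imports Defs
begin

text \<open>For a unimodular matrix \<open>A\<close> the volume of \<open>Z(A)\<close> is \<open>det (A A\<^sup>T)\<close>. To see this, scale column \<open>k\<close> by
  a weight \<open>t k\<close>. Both the volume of the zonotope and \<open>det (\<Sum>k. t k a\<^sub>k a\<^sub>k\<^sup>T)\<close> are affine in each weight
  and homogeneous of degree \<open>d\<close> in \<open>t\<close>; hence they agree everywhere once they agree on indicator
  functions of \<open>d\<close>-element sets \<open>S\<close>, where they are \<open>\<bar>det A\<^sub>S\<bar>\<close> and \<open>(det A\<^sub>S)\<^sup>2\<close>, which coincide by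
  unimodularity. With \<open>M = V V\<^sup>T\<close>, \<open>a = w\<^sup>T M\<inverse> w\<close>, \<open>b = w'\<^sup>T M\<inverse> w'\<close> and \<open>c = w\<^sup>T M\<inverse> w'\<close>, the matrix
  determinant lemma turns the four volumes into \<open>det M\<close> times \<open>1\<close>, \<open>1 + a\<close>, \<open>1 + b\<close> and
  \<open>(1 + a)(1 + b) - c\<^sup>2\<close>, so the two sides differ by \<open>(c det M)\<^sup>2\<close>.\<close>

section \<open>Volumes of linear images\<close>

text \<open>The library's \<open>measure_linear_image\<close> requires a well-ordered index type.\<close>

lemma measure_linear_image_det:
  fixes f :: "real^'n \<Rightarrow> real^'n"
  assumes "linear f" "S \<in> lmeasurable"
  shows "f ` S \<in> lmeasurable \<and> measure lebesgue (f ` S) = \<bar>det (matrix f)\<bar> * measure lebesgue S"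
proof -
  define P where "P f \<longleftrightarrow> (\<forall>S \<in> lmeasurable. f ` S \<in> lmeasurable \<and>
      measure lebesgue (f ` S) = \<bar>det (matrix f)\<bar> * measure lebesgue S)"
    for f :: "real^'n \<Rightarrow> real^'n"
  \<comment> \<open>For the volume-preserving elementary maps, swaps and shears, it suffices to
    compare volumes of boxes.\<close>
  have by_boxes: "P f"
    if "linear f" "\<bar>det (matrix f)\<bar> = 1"
      "\<And>a b. cbox a b \<noteq> {} \<Longrightarrow> measure lebesgue (f ` cbox a b) = measure lebesgue (cbox a b)"
    for f
  proof -
    have "measure lebesgue (f ` cbox a b) = 1 * measure lebesgue (cbox a b)" for a b
      by (cases "cbox a b = {}") (simp_all only: that(3) image_empty measure_empty mult_1 not_False_eq_True)
    from measure_linear_sufficient[OF \<open>linear f\<close> _ this] show ?thesis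
      by (metis P_def that(2))
  qed
  have "P f"
  \<comment> \<open>Every linear map is composed of maps into a coordinate hyperplane, diagonal
    stretches, coordinate swaps and shears.\<close>
  proof (rule induct_linear_elementary[OF \<open>linear f\<close>])
    show "P (f \<circ> g)" if "linear f" "linear g" "P f" "P g" for f g
      using that
      by (simp only: P_def matrix_compose det_mul abs_mult image_comp[symmetric]) (simp add: mult.assoc)
  next
    fix g :: "real^'n \<Rightarrow> real^'n" and i
    assume g: "linear g" "\<And>x. g x $ i = 0"
    have "\<not> surj g"
      using g(2) by (metis one_neq_zero surjE vec_component)
    then have "\<not> inj g"
      using g(1) linear_injective_imp_surjective by blast
    then have "det (matrix g) = 0" "\<And>S. negligible (g ` S)"
      using g(1) det_nz_iff_inj negligible_linear_singular_image by blast+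
    then show "P g"
      by (simp add: P_def negligible_iff_measure)
  next
    show "P (\<lambda>x. \<chi> i. c i * x $ i)" for c
      by (simp add: P_def measurable_stretch measure_stretch matrix_def axis_def det_diagonal)
  next
    fix m n :: 'n
    let ?p = "Transposition.transpose m n"
    let ?h = "\<lambda>x::real^'n. \<chi> i. x $ ?p i"
    have "matrix ?h = (\<chi> i. mat 1 $ ?p i)"
      by (simp add: vec_eq_iff matrix_def axis_def mat_def eq_commute)
    then have "\<bar>det (matrix ?h)\<bar> = 1"
      by (simp add: det_permute_rows permutes_swap_id sign_swap_id)
    moreover have "measure lebesgue (?h ` cbox a b) = measure lebesgue (cbox a b)"
      if "cbox a b \<noteq> {}" for a b
    proof -
      have "x \<in> ?h ` cbox a b \<longleftrightarrow> x \<in> cbox (?h a) (?h b)" for x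
      proof
        assume "x \<in> cbox (?h a) (?h b)"
        then have "?h x \<in> cbox a b"
          by (simp add: mem_box_cart) (metis transpose_involutory)
        moreover have "x = ?h (?h x)"
          by (simp add: vec_eq_iff)
        ultimately show "x \<in> ?h ` cbox a b"
          by blast
      qed (auto simp: mem_box_cart)
      then have eq: "?h ` cbox a b = cbox (?h a) (?h b)"
        by blast
      moreover have "cbox (?h a) (?h b) \<noteq> {}"
        using that eq by blast
      ultimately show ?thesis
        using that prod.permute[OF permutes_swap_id[of m UNIV n], of "\<lambda>i. b $ i - a $ i"]
        by (simp add: content_cbox_cart)
    qed
    moreover have "linear ?h"
      by (rule linearI) (simp_all add: vec_eq_iff)
    ultimately show "P ?h"
      by (intro by_boxes)
  next
    fix m n :: 'n
    assume "m \<noteq> n"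
    let ?h = "\<lambda>x::real^'n. \<chi> i. if i = m then x $ m + x $ n else x $ i"
    have lin: "linear ?h"
      by (rule linearI) (auto simp: vec_eq_iff algebra_simps)
    have "matrix ?h = (\<chi> k. if k = m then row m (mat 1) + 1 *s row n (mat 1) else row k (mat 1))"
      by (simp add: vec_eq_iff matrix_def axis_def mat_def row_def eq_commute)
    then have "\<bar>det (matrix ?h)\<bar> = 1"
      by (simp only: det_row_operation[OF \<open>m \<noteq> n\<close>]) simp
    moreover have "measure lebesgue (?h ` cbox a b) = measure lebesgue (cbox a b)"
      if "cbox a b \<noteq> {}" for a b
    proof -
      \<comment> \<open>Linearity and translation invariance reduce the claim to a box with lower
        corner 0, where \<open>measure_shear_interval\<close> applies.\<close>
      have box: "cbox a b = (+) a ` cbox 0 (b - a)"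
        by (simp flip: cbox_translation)
      have "?h ` cbox a b = (+) (?h a) ` ?h ` cbox 0 (b - a)"
        unfolding box image_image by (simp only: linear_add[OF lin])
      moreover have "cbox 0 (b - a) \<noteq> {}"
        using that box by blast
      ultimately show ?thesis
        using \<open>m \<noteq> n\<close> by (simp add: measure_translation measure_shear_interval box)
    qed
    ultimately show "P ?h"
      using lin by (intro by_boxes)
  qed
  with \<open>S \<in> lmeasurable\<close> show ?thesis
    by (simp add: P_def)
qed

section \<open>Rank-one updates of determinants\<close>

definition outer :: "real^'m \<Rightarrow> real^'n \<Rightarrow> real^'n^'m" where
  "outer u v = (\<chi> i j. u $ i * v $ j)"

lemma matrix_mul_outer: "Q ** outer u v = outer (Q *v u) v"
  by (simp add: outer_def vec_eq_iff matrix_matrix_mult_def matrix_vector_mult_def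
      sum_distrib_right mult.assoc)

lemma outer_mul_vector: "outer u v *v x = (v \<bullet> x) *\<^sub>R u"
  by (simp add: outer_def vec_eq_iff matrix_vector_mult_def inner_vec_def sum_distrib_right
      sum_distrib_left mult_ac)

text \<open>After a rotation taking \<open>u\<close> to a multiple of a basis vector, adding \<open>outer u v\<close> changes
  only one row.\<close>

lemma det_add_outer_row:
  fixes u :: "real^'n"
  obtains Q :: "real^'n^'n" and k where "orthogonal_matrix Q" "Q *v u = norm u *\<^sub>R axis k 1"
    "\<And>M v. det Q * det (M + outer u v)
       = det (Q ** M) + norm u * det (\<chi> i. if i = k then v else (Q ** M) $ i)"
proof -
  fix k :: 'n
  have "norm u = norm (norm u *\<^sub>R axis k (1::real))"
    by simp
  then obtain f :: "real^'n \<Rightarrow> real^'n" where f: "orthogonal_transformation f" "f u = norm u *\<^sub>R axis k 1"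
    by (rule orthogonal_transformation_exists) blast
  define Q where "Q = matrix f"
  have Q: "orthogonal_matrix Q" "Q *v u = norm u *\<^sub>R axis k 1"
    using f by (auto simp: Q_def orthogonal_transformation_matrix)
  have "det Q * det (M + outer u v)
      = det (Q ** M) + norm u * det (\<chi> i. if i = k then v else (Q ** M) $ i)" for M v
  proof -
    have "Q ** (M + outer u v)
        = (\<chi> i. if i = k then (Q ** M) $ i + norm u *s v else (Q ** M) $ i)"
      by (simp add: matrix_add_ldistrib matrix_mul_outer Q(2))
        (simp add: vec_eq_iff outer_def axis_def)
    then have "det (Q ** (M + outer u v))
        = det (\<chi> i. if i = k then (Q ** M) $ i else (Q ** M) $ i)
          + norm u * det (\<chi> i. if i = k then v else (Q ** M) $ i)"
      by (simp only: det_row_add det_row_mul)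
    then show ?thesis
      by (simp add: det_mul)
  qed
  with Q that show thesis
    by blast
qed

text \<open>In the coordinates of \<open>det_add_outer_row\<close> the vector \<open>v\<close>
  enters a single row, and the determinant is linear in that row; hence it is affine in
  \<open>s\<close>.\<close>

lemma det_add_outer_scaleR:
  fixes M :: "real^'n^'n"
  shows "det (M + outer u (s *\<^sub>R v)) = det M + s * (det (M + outer u v) - det M)"
proof -
  obtain Q :: "real^'n^'n" and k where Q: "orthogonal_matrix Q" "Q *v u = norm u *\<^sub>R axis k 1"
    and row: "\<And>M v. det Q * det (M + outer u v)
       = det (Q ** M) + norm u * det (\<chi> i. if i = k then v else (Q ** M) $ i)"
    by (rule det_add_outer_row[of u]) blast
  have "det (\<chi> i. if i = k then s *\<^sub>R v else (Q ** M) $ i)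
      = s * det (\<chi> i. if i = k then v else (Q ** M) $ i)"
    using det_row_mul[of k s "\<lambda>_. v"] by (simp only: scalar_mult_eq_scaleR)
  then have "det Q * det (M + outer u (s *\<^sub>R v))
      = det Q * (det M + s * (det (M + outer u v) - det M))"
    using row[of M v] row[of M "s *\<^sub>R v"] by (simp add: det_mul algebra_simps)
  moreover have "det Q \<noteq> 0"
    using det_orthogonal_matrix[OF Q(1)] by auto
  ultimately show ?thesis
    by simp
qed

text \<open>By Cramer's rule, replacing row \<open>k\<close> of an orthogonal \<open>Q\<close> by
  \<open>v\<close> multiplies the determinant by coordinate \<open>k\<close> of
  \<open>Q *v v\<close>. As \<open>Q *v u\<close> lies on axis \<open>k\<close>, this coordinate
  times \<open>norm u\<close> is an inner product, which \<open>Q\<close> preserves.\<close>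

lemma det_mat_1_add_outer:
  fixes u v :: "real^'n"
  shows "det (mat 1 + outer u v) = 1 + v \<bullet> u"
proof -
  obtain Q :: "real^'n^'n" and k where Q: "orthogonal_matrix Q" "Q *v u = norm u *\<^sub>R axis k 1"
    and row: "\<And>M v. det Q * det (M + outer u v)
       = det (Q ** M) + norm u * det (\<chi> i. if i = k then v else (Q ** M) $ i)"
    by (rule det_add_outer_row[of u]) blast
  have QQ: "transpose Q ** Q = mat 1"
    using Q(1) by (simp add: orthogonal_matrix)
  have "(\<Sum>i\<in>UNIV. (Q *v v) $ i *s row i Q) = transpose Q *v (Q *v v)"
    by (simp add: matrix_mult_sum column_transpose)
  also have "\<dots> = v"
    by (simp add: matrix_vector_mul_assoc QQ)
  finally have "det (\<chi> i. if i = k then v else Q $ i) = (Q *v v) $ k * det Q"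
    using cramer_lemma_transpose[of k "Q *v v" Q] by (simp add: row_def cong: if_cong)
  moreover have "norm u * (Q *v v) $ k = (Q *v v) \<bullet> (Q *v u)"
    by (simp add: Q(2) inner_axis)
  moreover have "\<dots> = v \<bullet> u"
    by (metis QQ dot_lmul_matrix matrix_vector_mul_assoc matrix_vector_mul_lid
        vector_transpose_matrix transpose_transpose)
  ultimately have "det Q * det (mat 1 + outer u v) = det Q * (1 + v \<bullet> u)"
    using row[of "mat 1" v, unfolded matrix_mul_rid] by (simp add: algebra_simps)
  moreover have "det Q \<noteq> 0"
    using det_orthogonal_matrix[OF Q(1)] by auto
  ultimately show ?thesis
    by simp
qed

lemma det_add_outer:
  fixes M N :: "real^'n^'n"
  assumes "M ** N = mat 1"
  shows "det (M + outer u v) = det M * (1 + v \<bullet> (N *v u))"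
proof -
  have "M + outer u v = M ** (mat 1 + outer (N *v u) v)"
    by (simp add: matrix_add_ldistrib matrix_mul_outer matrix_vector_mul_assoc assms)
  then show ?thesis
    by (simp add: det_mul det_mat_1_add_outer)
qed

text \<open>The Sherman-Morrison formula applied to a vector: the right-hand side solves
  \<open>(M + outer u v) *v y = x\<close>, and the solution is unique.\<close>

lemma inverse_add_outer_mul_vector:
  fixes M N :: "real^'n^'n"
  assumes MN: "M ** N = mat 1" and "1 + v \<bullet> (N *v u) \<noteq> 0"
    and inv: "(M + outer u v) ** N' = mat 1"
  shows "N' *v x = N *v x - ((v \<bullet> (N *v x)) / (1 + v \<bullet> (N *v u))) *\<^sub>R (N *v u)"
proof -
  let ?y = "N *v x - ((v \<bullet> (N *v x)) / (1 + v \<bullet> (N *v u))) *\<^sub>R (N *v u)"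
  let ?c = "(v \<bullet> (N *v x)) / (1 + v \<bullet> (N *v u))"
  have "M *v ?y = x - ?c *\<^sub>R u"
    by (simp add: matrix_vector_mult_diff_distrib matrix_vector_mult_scaleR
        matrix_vector_mul_assoc MN)
  moreover have "v \<bullet> ?y = ?c"
    using assms(2) by (simp add: inner_diff_right field_simps)
  ultimately have "(M + outer u v) *v ?y = x"
    by (simp add: matrix_vector_mult_add_rdistrib outer_mul_vector)
  moreover have "N' ** (M + outer u v) = mat 1"
    using inv matrix_left_right_inverse by blast
  ultimately show ?thesis
    by (metis matrix_vector_mul_assoc matrix_vector_mul_lid)
qed

text \<open>The determinant lemma serves for both updates; in the second, the inverse of
  \<open>M + outer w w\<close>, which exists by \<open>nz\<close>, is eliminated by the
  Sherman-Morrison formula.\<close>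

lemma det_add_outer_add_outer:
  fixes M N :: "real^'n^'n"
  assumes MN: "M ** N = mat 1" and nz: "1 + w \<bullet> (N *v w) \<noteq> 0"
  shows "det (M + outer w w + outer w' w')
    = det M * ((1 + w \<bullet> (N *v w)) * (1 + w' \<bullet> (N *v w')) - (w \<bullet> (N *v w')) * (w' \<bullet> (N *v w)))"
proof -
  have "det M \<noteq> 0"
    using MN invertible_det_nz invertible_right_inverse by blast
  then have "det (M + outer w w) \<noteq> 0"
    using nz by (simp add: det_add_outer[OF MN])
  then obtain N' where N': "(M + outer w w) ** N' = mat 1"
    using invertible_det_nz invertible_right_inverse by blast
  show ?thesis
    using nz unfolding det_add_outer[OF N'] det_add_outer[OF MN]
      inverse_add_outer_mul_vector[OF MN nz N']
    by (simp add: inner_diff_right field_simps)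
qed

section \<open>Gram matrices with weighted columns\<close>

definition weighted_gram :: "real^'m^'d \<Rightarrow> ('m \<Rightarrow> real) \<Rightarrow> real^'d^'d" where
  "weighted_gram A t = (\<chi> i j. \<Sum>k\<in>UNIV. t k * (A $ i $ k * A $ j $ k))"

lemma weighted_gram_upd:
  "weighted_gram A (t(k := s)) = weighted_gram A (t(k := 0)) + outer (column k A) (s *\<^sub>R column k A)"
proof -
  have "(\<Sum>j\<in>UNIV. (t(k := s)) j * g j) = (\<Sum>j\<in>UNIV. (t(k := 0)) j * g j) + s * g k" for g
    by (simp add: sum.remove[of UNIV k])
  then show ?thesis
    by (simp add: vec_eq_iff weighted_gram_def outer_def column_def del: fun_upd_apply)
qed

lemma det_weighted_gram_upd:
  "det (weighted_gram A (t(k := s)))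
    = det (weighted_gram A (t(k := 0)))
      + s * (det (weighted_gram A (t(k := 1))) - det (weighted_gram A (t(k := 0))))"
  using weighted_gram_upd[of A t k s] weighted_gram_upd[of A t k 1]
  by (simp add: det_add_outer_scaleR)

lemma det_weighted_gram_scale:
  fixes A :: "real^'m^'d"
  shows "det (weighted_gram A (\<lambda>k. c * t k)) = c ^ CARD('d) * det (weighted_gram A t)"
proof -
  have "weighted_gram A (\<lambda>k. c * t k) = (\<chi> i. c *s weighted_gram A t $ i)"
    by (simp add: vec_eq_iff weighted_gram_def sum_distrib_left mult_ac)
  then show ?thesis
    by (simp add: det_rows_mul)
qed

text \<open>Columns outside \<open>S\<close> get weight 0, leaving the Gram matrix of a square
  submatrix, whose determinant is a square.\<close>

lemma weighted_gram_indicator: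
  fixes A :: "real^'m^'d" and f :: "'d \<Rightarrow> 'm"
  assumes "bij_betw f UNIV S"
  shows "weighted_gram A (indicator S)
    = (\<chi> i j. A $ i $ f j) ** transpose (\<chi> i j. A $ i $ f j)"
proof -
  have "(\<Sum>k\<in>UNIV. indicator S k * g k) = (\<Sum>j\<in>UNIV. g (f j))" for g :: "'m \<Rightarrow> real"
    using sum.reindex_bij_betw[OF assms, of g] by (simp add: indicator_def if_distrib sum.If_cases)
  then show ?thesis
    by (simp add: vec_eq_iff weighted_gram_def matrix_matrix_mult_def transpose_def)
qed

section \<open>Volumes of zonotopes\<close>

text \<open>For \<open>0 \<le> s\<close> this is the Minkowski sum of \<open>C\<close> and the
  segment from 0 to \<open>s *\<^sub>R w\<close>; the parameter \<open>s\<close> allows the growth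
  of the volume to be followed.\<close>

definition sweep :: "'a::real_vector set \<Rightarrow> 'a \<Rightarrow> real \<Rightarrow> 'a set" where
  "sweep C w s = {x + u *\<^sub>R w | x u. x \<in> C \<and> u \<in> {0..s}}"

lemma compact_sweep:
  fixes w :: "'a::real_normed_vector"
  assumes "compact C"
  shows "compact (sweep C w s)"
proof -
  have "sweep C w s = (\<lambda>z. fst z + snd z *\<^sub>R w) ` (C \<times> {0..s})"
    by (force simp: sweep_def)
  moreover have "compact \<dots>"
    by (intro compact_continuous_image continuous_intros compact_Times assms) simp
  ultimately show ?thesis
    by simp
qed

lemma sweep_0 [simp]: "sweep C w 0 = C"
  by (simp add: sweep_def)

lemma sweep_mono: "s \<le> r \<Longrightarrow> sweep C w s \<subseteq> sweep C w r"
  unfolding sweep_def by (smt (verit) Collect_mono atLeastAtMost_iff)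

text \<open>On each line parallel to \<open>w\<close> the set \<open>C\<close> is an interval, and sweeping only moves its far
  end.\<close>

lemma sweep_diff_eq_translation:
  fixes C :: "'a::real_vector set"
  assumes "convex C" "0 \<le> r" "0 \<le> s"
  shows "sweep C w (s + r) - sweep C w s = (+) (s *\<^sub>R w) ` (sweep C w r - C)"
proof (intro equalityI subsetI)
  fix y assume y: "y \<in> sweep C w (s + r) - sweep C w s"
  then obtain x u where xu: "y = x + u *\<^sub>R w" "x \<in> C" "0 \<le> u" "u \<le> s + r"
    by (auto simp: sweep_def)
  have "s < u"
    using xu y by (force simp: sweep_def)
  have eq: "y - s *\<^sub>R w = x + (u - s) *\<^sub>R w"
    using xu by (simp add: algebra_simps)
  have "y - s *\<^sub>R w \<in> sweep C w r"
    unfolding eq sweep_def using xu \<open>s < u\<close> by force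
  moreover have "y - s *\<^sub>R w \<notin> C"
  proof
    assume "y - s *\<^sub>R w \<in> C"
    then have "(y - s *\<^sub>R w) + s *\<^sub>R w \<in> sweep C w s"
      unfolding sweep_def using \<open>0 \<le> s\<close> by fastforce
    then show False
      using y by simp
  qed
  ultimately show "y \<in> (+) (s *\<^sub>R w) ` (sweep C w r - C)"
    by (intro image_eqI[of _ _ "y - s *\<^sub>R w"]) auto
next
  fix y assume "y \<in> (+) (s *\<^sub>R w) ` (sweep C w r - C)"
  then obtain z where z: "y = s *\<^sub>R w + z" "z \<in> sweep C w r" "z \<notin> C"
    by auto
  then obtain x u where xu: "z = x + u *\<^sub>R w" "x \<in> C" "0 \<le> u" "u \<le> r"
    by (auto simp: sweep_def)
  have eq: "y = x + (s + u) *\<^sub>R w"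
    using z xu by (simp add: algebra_simps)
  have "y \<in> sweep C w (s + r)"
    unfolding eq sweep_def using xu \<open>0 \<le> s\<close> by force
  moreover have "y \<notin> sweep C w s"
  proof
    assume "y \<in> sweep C w s"
    then obtain c v where cv: "y = c + v *\<^sub>R w" "c \<in> C" "0 \<le> v" "v \<le> s"
      by (auto simp: sweep_def)
    \<comment> \<open>The points \<open>x\<close>, \<open>z\<close>, \<open>c\<close> follow one
      another in direction \<open>w\<close> with gaps \<open>u\<close> and \<open>a\<close>, so
      \<open>z\<close> is a convex combination of \<open>x\<close> and \<open>c\<close>,
      contradicting \<open>z \<notin> C\<close>.\<close>
    define a where "a = s - v"
    have "0 \<le> a" and c: "c = z + a *\<^sub>R w"
      using cv z by (auto simp: a_def algebra_simps)
    have "z \<noteq> c"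
      using cv z by blast
    then have "a \<noteq> 0"
      using c by auto
    with \<open>0 \<le> a\<close> \<open>0 \<le> u\<close> have "0 < a + u"
      by simp
    have "(a / (a + u)) *\<^sub>R x + (u / (a + u)) *\<^sub>R c \<in> C"
      using \<open>convex C\<close> xu cv \<open>0 \<le> a\<close> \<open>0 < a + u\<close>
      by (intro convexD) (auto simp flip: add_divide_distrib)
    moreover have "(a / (a + u)) *\<^sub>R x + (u / (a + u)) *\<^sub>R c = z"
    proof -
      have x: "x = z - u *\<^sub>R w"
        using xu by simp
      have "(a / (a + u)) *\<^sub>R x + (u / (a + u)) *\<^sub>R c = (a / (a + u) + u / (a + u)) *\<^sub>R z"
        unfolding x c by (simp add: algebra_simps)
      then show ?thesis
        using \<open>0 < a + u\<close> by (simp flip: add_divide_distrib)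
    qed
    ultimately show False
      using z by simp
  qed
  ultimately show "y \<in> sweep C w (s + r) - sweep C w s"
    by blast
qed

text \<open>Sweeping on from \<open>s\<close> to \<open>s + r\<close> adds a translate of what a
  sweep by \<open>r\<close> adds to \<open>C\<close>, so both gain the same volume.\<close>

lemma measure_sweep_add:
  fixes C :: "'a::euclidean_space set"
  assumes "compact C" "convex C" "0 \<le> r" "0 \<le> s"
  shows "measure lebesgue (sweep C w (s + r)) - measure lebesgue (sweep C w s)
    = measure lebesgue (sweep C w r) - measure lebesgue C"
proof -
  have diff: "measure lebesgue (sweep C w b - sweep C w a)
      = measure lebesgue (sweep C w b) - measure lebesgue (sweep C w a)" if "a \<le> b" for a b
    using that assms(1)
    by (intro measurable_measure_Diff sweep_mono fmeasurableD lmeasurable_compact compact_sweep)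
  show ?thesis
    using diff[of s "s + r"] diff[of 0 r] assms
    by (simp add: sweep_diff_eq_translation measure_translation)
qed

text \<open>As a linear image of a box, the sum of the segments from 0 to \<open>t k\<close> times
  column \<open>k\<close> is at once compact and convex. A negative weight makes the box, hence the
  set, empty.\<close>

definition weighted_zonotope :: "real^'m^'d \<Rightarrow> ('m \<Rightarrow> real) \<Rightarrow> (real^'d) set" where
  "weighted_zonotope A t = (*v) A ` cbox 0 (\<chi> k. t k)"

lemma compact_weighted_zonotope: "compact (weighted_zonotope A t)"
  unfolding weighted_zonotope_def
  by (intro compact_continuous_image continuous_intros compact_cbox)

lemma convex_weighted_zonotope: "convex (weighted_zonotope A t)"
  unfolding weighted_zonotope_def by (intro convex_linear_image matrix_vector_mul_linear convex_box)

lemma weighted_zonotope_upd: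
  assumes "0 \<le> s"
  shows "weighted_zonotope A (t(k := s)) = sweep (weighted_zonotope A (t(k := 0))) (column k A) s"
proof (intro equalityI subsetI)
  fix y assume "y \<in> weighted_zonotope A (t(k := s))"
  then obtain x where x: "y = A *v x" "\<forall>i. 0 \<le> x $ i \<and> x $ i \<le> (t(k := s)) i"
    by (auto simp: weighted_zonotope_def mem_box_cart)
  define x' where "x' = x - x $ k *\<^sub>R axis k 1"
  have "0 \<le> x' $ i \<and> x' $ i \<le> (t(k := 0)) i" for i
    using x(2)[rule_format, of i] by (cases "i = k") (simp_all add: x'_def axis_def)
  then have "x' \<in> cbox 0 (\<chi> i. (t(k := 0)) i)"
    by (simp add: mem_box_cart)
  then have "A *v x' \<in> weighted_zonotope A (t(k := 0))"
    by (auto simp: weighted_zonotope_def)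
  moreover have "y = A *v x' + x $ k *\<^sub>R column k A"
    by (simp add: x x'_def matrix_vector_mult_diff_distrib matrix_vector_mult_scaleR
        matrix_vector_mult_basis)
  moreover have "0 \<le> x $ k" "x $ k \<le> s"
    using x(2)[rule_format, of k] by simp_all
  ultimately show "y \<in> sweep (weighted_zonotope A (t(k := 0))) (column k A) s"
    by (auto simp: sweep_def)
next
  fix y assume "y \<in> sweep (weighted_zonotope A (t(k := 0))) (column k A) s"
  then obtain x u where y: "y = A *v x + u *\<^sub>R column k A" and u: "0 \<le> u" "u \<le> s"
    and x: "\<forall>i. 0 \<le> x $ i \<and> x $ i \<le> (t(k := 0)) i"
    by (auto simp: sweep_def weighted_zonotope_def mem_box_cart)
  have "x $ k = 0"
    using x[rule_format, of k] by simp
  then have "0 \<le> (x + u *\<^sub>R axis k 1) $ i \<and> (x + u *\<^sub>R axis k 1) $ i \<le> (t(k := s)) i" for i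
    using x[rule_format, of i] u by (cases "i = k") (simp_all add: axis_def)
  then have "x + u *\<^sub>R axis k 1 \<in> cbox 0 (\<chi> i. (t(k := s)) i)"
    by (simp add: mem_box_cart)
  moreover have "y = A *v (x + u *\<^sub>R axis k 1)"
    by (simp add: y matrix_vector_right_distrib matrix_vector_mult_scaleR matrix_vector_mult_basis)
  ultimately show "y \<in> weighted_zonotope A (t(k := s))"
    by (auto simp: weighted_zonotope_def)
qed

text \<open>Two successive unit sweeps along column \<open>k\<close> add equal volume. The weights
  0, 1 and 2 are all that the doubling argument looks at.\<close>

lemma measure_weighted_zonotope_upd_double:
  "measure lebesgue (weighted_zonotope A (t(k := 2)))
    = 2 * measure lebesgue (weighted_zonotope A (t(k := 1)))
      - measure lebesgue (weighted_zonotope A (t(k := 0)))"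
  using measure_sweep_add[of "weighted_zonotope A (t(k := 0))" 1 1 "column k A"]
  by (simp add: weighted_zonotope_upd[of 1] weighted_zonotope_upd[of 2] compact_weighted_zonotope convex_weighted_zonotope)

lemma measure_weighted_zonotope_double:
  fixes A :: "real^'m^'d"
  shows "measure lebesgue (weighted_zonotope A (\<lambda>k. 2 * t k))
    = 2 ^ CARD('d) * measure lebesgue (weighted_zonotope A t)"
proof -
  have "cbox 0 (\<chi> k. 2 * t k) = (*\<^sub>R) 2 ` cbox 0 (\<chi> k. t k)"
  proof (intro equalityI subsetI)
    fix x assume "x \<in> cbox 0 (\<chi> k. 2 * t k)"
    then have "(1/2) *\<^sub>R x \<in> cbox 0 (\<chi> k. t k)"
      by (auto simp: mem_box_cart mult.commute)
    moreover have "x = 2 *\<^sub>R (1/2) *\<^sub>R x"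
      by simp
    ultimately show "x \<in> (*\<^sub>R) 2 ` cbox 0 (\<chi> k. t k)"
      by blast
  qed (auto simp: mem_box_cart)
  then have "weighted_zonotope A (\<lambda>k. 2 * t k) = (\<lambda>x. 0 + 2 *\<^sub>R x) ` weighted_zonotope A t"
    by (simp add: weighted_zonotope_def image_image matrix_vector_mult_scaleR)
  then show ?thesis
    using measure_lebesgue_affine[of 2 0 "weighted_zonotope A t"] by simp
qed

text \<open>Weight 0 pins the coordinates outside \<open>S\<close> at 0, and \<open>f\<close>
  identifies the remaining face of the box with the unit cube.\<close>

lemma weighted_zonotope_indicator:
  fixes A :: "real^'m^'d" and f :: "'d \<Rightarrow> 'm"
  assumes f: "bij_betw f UNIV S"
  shows "weighted_zonotope A (indicator S) = (*v) (\<chi> i j. A $ i $ f j) ` cbox 0 1"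
proof -
  have S: "S = range f" and "inj f"
    using f by (auto simp: bij_betw_def)
  have mult: "A *v x = (\<chi> i j. A $ i $ f j) *v (\<chi> j. x $ f j)"
    if "\<And>k. k \<notin> S \<Longrightarrow> x $ k = 0" for x
  proof -
    have "(\<Sum>k\<in>UNIV. g k * x $ k) = (\<Sum>j\<in>UNIV. g (f j) * x $ f j)" for g
    proof -
      have "(\<Sum>k\<in>UNIV. g k * x $ k) = (\<Sum>k\<in>S. g k * x $ k)"
        using that by (intro sum.mono_neutral_right) auto
      then show ?thesis
        using sum.reindex_bij_betw[OF f, of "\<lambda>k. g k * x $ k"] by simp
    qed
    then show ?thesis
      by (simp add: vec_eq_iff matrix_vector_mult_def)
  qed
  show ?thesis
  proof (intro equalityI subsetI)
    fix y assume "y \<in> weighted_zonotope A (indicator S)"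
    then obtain x where x: "y = A *v x" "\<forall>k. 0 \<le> x $ k \<and> x $ k \<le> indicator S k"
      by (auto simp: weighted_zonotope_def mem_box_cart)
    have "y = (\<chi> i j. A $ i $ f j) *v (\<chi> j. x $ f j)"
      unfolding x(1) using x(2) by (intro mult) (metis antisym indicator_simps(2))
    moreover have "(\<chi> j. x $ f j) \<in> cbox 0 1"
      using x(2) S by (auto simp: mem_box_cart) (metis indicator_simps(1) rangeI)
    ultimately show "y \<in> (*v) (\<chi> i j. A $ i $ f j) ` cbox 0 1"
      by blast
  next
    fix y assume "y \<in> (*v) (\<chi> i j. A $ i $ f j) ` cbox 0 1"
    then obtain z where z: "y = (\<chi> i j. A $ i $ f j) *v z" "\<forall>j. 0 \<le> z $ j \<and> z $ j \<le> 1"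
      by (auto simp: mem_box_cart)
    define x where "x = (\<chi> k. if k \<in> S then z $ inv f k else 0)"
    have "(\<chi> j. x $ f j) = z"
      using \<open>inj f\<close> S by (simp add: vec_eq_iff x_def)
    then have "y = A *v x"
      using mult[of x] z by (simp add: x_def)
    moreover have "x \<in> cbox 0 (\<chi> k. indicator S k)"
      using z by (auto simp: mem_box_cart x_def)
    ultimately show "y \<in> weighted_zonotope A (indicator S)"
      by (auto simp: weighted_zonotope_def)
  qed
qed

lemma measure_weighted_zonotope_indicator:
  fixes A :: "real^'m^'d" and f :: "'d \<Rightarrow> 'm"
  assumes "bij_betw f UNIV S"
  shows "measure lebesgue (weighted_zonotope A (indicator S)) = \<bar>det (\<chi> i j. A $ i $ f j)\<bar>"
proof -
  have "(0::real^'d) \<in> cbox 0 1"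
    by (simp add: mem_box_cart)
  then have "cbox 0 1 \<noteq> ({} :: (real^'d) set)"
    by blast
  then have "measure lebesgue (cbox 0 (1 :: real^'d)) = 1"
    by (simp add: content_cbox_cart)
  then show ?thesis
    using measure_linear_image_det[OF matrix_vector_mul_linear, of "cbox 0 1" "\<chi> i j. A $ i $ f j"]
    by (simp add: weighted_zonotope_indicator[OF assms])
qed

text \<open>Adding the indicator of \<open>T \<subseteq> S\<close> raises weights on \<open>S\<close> from 1 to 2. If \<open>D\<close> vanishes for smaller
  supports, each such raise doubles it, so raising all of \<open>S\<close> yields the factor \<open>2 ^ card S\<close>, which
  contradicts the degree \<open>d\<close> unless \<open>card S = d\<close> or \<open>D = 0\<close>.\<close>

lemma double_affine_homogeneous_eq_0:
  fixes D :: "('m::finite \<Rightarrow> real) \<Rightarrow> real"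
  assumes affine: "\<And>t k. D (t(k := 2)) = 2 * D (t(k := 1)) - D (t(k := 0))"
    and homogeneous: "\<And>t. D (\<lambda>k. 2 * t k) = 2 ^ d * D t"
    and base: "\<And>S. card S = d \<Longrightarrow> D (indicator S) = 0"
  shows "D (indicator S) = 0"
proof -
  define E where "E S T = D (\<lambda>i. indicator S i + indicator T i)" for S T
  \<comment> \<open>The claim is strengthened to all \<open>T\<close> because lowering a weight of
    \<open>S\<close> to 0 leads to \<open>S - {k}\<close> with the same \<open>T\<close>.\<close>
  have "\<forall>T\<subseteq>S. E S T = 0"
    using finite[of S]
  proof (induction S rule: finite_psubset_induct)
    case (psubset S)
    have double: "E S T = 2 ^ card T * D (indicator S)" if "T \<subseteq> S" for T
      using finite[of T] that
    proof (induction T rule: finite_induct)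
      case empty
      then show ?case
        by (simp add: E_def)
    next
      case (insert k T)
      let ?t = "\<lambda>i. indicator S i + indicator T i :: real"
      \<comment> \<open>As \<open>k\<close> is in \<open>S\<close> but not yet in \<open>T\<close>,
        its weight is 1; raising it to 2 inserts \<open>k\<close> into \<open>T\<close>, and
        lowering it to 0 removes \<open>k\<close> from \<open>S\<close>.\<close>
      have "?t(k := 2) = (\<lambda>i. indicator S i + indicator (insert k T) i)"
        "?t(k := 1) = ?t" "?t(k := 0) = (\<lambda>i. indicator (S - {k}) i + indicator T i)"
        using insert by (auto simp: fun_eq_iff indicator_def)
      then have "E S (insert k T) = 2 * E S T - E (S - {k}) T"
        using affine[of ?t k] by (simp add: E_def)
      moreover have "E (S - {k}) T = 0"
        using insert by (intro psubset.IH[rule_format]) auto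
      ultimately show ?case
        using insert by simp
    qed
    have "D (indicator S) = 0"
    proof (cases "card S = d")
      case False
      have "E S S = 2 ^ d * D (indicator S)"
        using homogeneous[of "indicator S"] by (simp add: E_def)
      moreover have "(2::real) ^ card S \<noteq> 2 ^ d"
        using False by simp
      ultimately show ?thesis
        using double[of S] by simp
    qed (rule base)
    then show ?case
      by (simp add: double)
  qed
  moreover have "E S {} = D (indicator S)"
    by (simp add: E_def)
  ultimately show ?thesis
    by (metis empty_subsetI)
qed

section \<open>From weights back to the volume of a unimodular zonotope\<close>

lemma zonotopeI: "(\<And>i. c i \<in> {0..1}) \<Longrightarrow> (\<Sum>i\<in>UNIV. c i *\<^sub>R column i A) \<in> zonotope A"
  by (auto simp: zonotope_def)

lemma weighted_zonotope_1: "weighted_zonotope A (indicator UNIV) = zonotope A"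
proof (intro equalityI subsetI)
  fix y assume "y \<in> weighted_zonotope A (indicator UNIV)"
  then obtain x where "y = A *v x" "\<forall>i. x $ i \<in> {0..1}"
    by (auto simp: weighted_zonotope_def mem_box_cart)
  then show "y \<in> zonotope A"
    unfolding zonotope_def matrix_mult_sum scalar_mult_eq_scaleR by blast
next
  fix y assume "y \<in> zonotope A"
  then obtain c where c: "y = (\<Sum>i\<in>UNIV. c i *\<^sub>R column i A)" "\<forall>i. c i \<in> {0..1}"
    by (auto simp: zonotope_def)
  then have "y = A *v (\<chi> i. c i)"
    by (simp add: matrix_mult_sum scalar_mult_eq_scaleR)
  moreover have "(\<chi> i. c i) \<in> cbox 0 (\<chi> i. indicator UNIV i)"
    using c by (simp add: mem_box_cart)
  ultimately show "y \<in> weighted_zonotope A (indicator UNIV)"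
    unfolding weighted_zonotope_def by blast
qed

theorem measure_zonotope_unimodular:
  fixes A :: "real^'m^'d"
  assumes "unimodular A"
  shows "measure lebesgue (zonotope A) = det (A ** transpose A)"
proof -
  define D where "D t = measure lebesgue (weighted_zonotope A t) - det (weighted_gram A t)" for t
  have "D (indicator UNIV) = 0"
  proof (rule double_affine_homogeneous_eq_0)
    show "D (t(k := 2)) = 2 * D (t(k := 1)) - D (t(k := 0))" for t k
      using det_weighted_gram_upd[of A t k 2]
      by (simp add: D_def measure_weighted_zonotope_upd_double)
    show "D (\<lambda>k. 2 * t k) = 2 ^ CARD('d) * D t" for t
      by (simp add: D_def measure_weighted_zonotope_double det_weighted_gram_scale
          right_diff_distrib)
    show "D (indicator S) = 0" if card: "card S = CARD('d)" for S
    proof -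
      obtain f :: "'d \<Rightarrow> 'm" where f: "bij_betw f UNIV S"
        using finite_same_card_bij[OF finite finite card[symmetric]] by blast
      let ?B = "\<chi> i j. A $ i $ f j"
      \<comment> \<open>Unimodularity enters here: on -1, 0 and 1 the absolute value and the square
        agree.\<close>
      have "det ?B \<in> {-1, 0, 1}"
        using assms f by (auto simp: unimodular_def bij_betw_def)
      then show ?thesis
        by (auto simp: D_def measure_weighted_zonotope_indicator[OF f]
            weighted_gram_indicator[OF f] det_mul)
    qed
  qed
  moreover have "weighted_gram A (indicator UNIV) = A ** transpose A"
    by (simp add: vec_eq_iff weighted_gram_def matrix_matrix_mult_def transpose_def)
  ultimately show ?thesis
    by (simp add: D_def flip: weighted_zonotope_1)
qed

lemma zonotope_append_column:
  "zonotope (append_column A w) = zonotope A + closed_segment 0 w"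
proof (intro equalityI subsetI)
  have eq: "(\<Sum>i\<in>UNIV. c i *\<^sub>R column i (append_column A w))
      = (\<Sum>i\<in>UNIV. c (Some i) *\<^sub>R column i A) + c None *\<^sub>R w" for c
    by (simp add: UNIV_option_conv sum.reindex column_def append_column_def vec_eq_iff)
  {
    fix y assume "y \<in> zonotope (append_column A w)"
    then obtain c where c: "\<forall>i. c i \<in> {0..1}"
      "y = (\<Sum>i\<in>UNIV. c (Some i) *\<^sub>R column i A) + c None *\<^sub>R w"
      unfolding zonotope_def eq by blast
    moreover have "(\<Sum>i\<in>UNIV. c (Some i) *\<^sub>R column i A) \<in> zonotope A"
      using c(1) by (intro zonotopeI) blast
    moreover have "c None *\<^sub>R w \<in> closed_segment 0 w"
      using c(1) by (auto simp: in_segment)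
    ultimately show "y \<in> zonotope A + closed_segment 0 w"
      by (auto intro: set_plus_intro)
  next
    fix y assume "y \<in> zonotope A + closed_segment 0 w"
    then obtain c u where c: "\<forall>i. c i \<in> {0..1}" and u: "0 \<le> u" "u \<le> 1"
      and y: "y = (\<Sum>i\<in>UNIV. c i *\<^sub>R column i A) + u *\<^sub>R w"
      by (auto simp: zonotope_def in_segment elim!: set_plus_elim)
    define c' where "c' i = (case i of None \<Rightarrow> u | Some k \<Rightarrow> c k)" for i
    have "y = (\<Sum>i\<in>UNIV. c' i *\<^sub>R column i (append_column A w))"
      unfolding eq by (simp add: y c'_def)
    moreover have "\<forall>i. c' i \<in> {0..1}"
      using c u by (auto simp: c'_def split: option.split)
    ultimately show "y \<in> zonotope (append_column A w)"
      by (simp only: zonotopeI)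
  }
qed

section \<open>Adding two generators\<close>

lemma append_column_mult_transpose:
  "append_column A w ** transpose (append_column A w) = A ** transpose A + outer w w"
  by (simp add: vec_eq_iff matrix_matrix_mult_def transpose_def append_column_def outer_def
      UNIV_option_conv sum.reindex)

text \<open>Injective column choices for \<open>A\<close> compose with \<open>g\<close> to such
  choices for \<open>B\<close>, so the maximal minors of \<open>A\<close> are among those of
  \<open>B\<close>.\<close>

lemma unimodular_reindex:
  fixes A :: "real^'m^'d" and B :: "real^'k^'d"
  assumes "unimodular B" "inj g" "\<And>i j. A $ i $ j = B $ i $ g j"
  shows "unimodular A"
  unfolding unimodular_def
proof (intro allI impI)
  fix f :: "'d \<Rightarrow> 'm" assume "inj f"
  then have "inj (g \<circ> f)"
    using \<open>inj g\<close> by (rule inj_compose[rotated])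
  then show "det (\<chi> i j. A $ i $ f j) \<in> {-1, 0, 1}"
    using assms(1,3) by (auto simp: unimodular_def)
qed

text \<open>Full row rank makes \<open>transpose V\<close> injective, and the quadratic form of
  \<open>V ** transpose V\<close> at \<open>x\<close> is the squared norm of
  \<open>transpose V *v x\<close>, so the kernel is trivial. The second identity exhibits the form
  of \<open>N\<close> as symmetric and nonnegative.\<close>

lemma mult_transpose_inverse:
  fixes V :: "real^'n^'d"
  assumes "rank V = CARD('d)"
  defines "N \<equiv> matrix_inv (V ** transpose V)"
  shows "V ** transpose V ** N = mat 1"
    and "x \<bullet> (N *v y) = (transpose V *v (N *v x)) \<bullet> (transpose V *v (N *v y))"
proof -
  let ?M = "V ** transpose V"
  have dot: "x \<bullet> (?M *v y) = (transpose V *v x) \<bullet> (transpose V *v y)" for x y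
    by (metis dot_lmul_matrix matrix_vector_mul_assoc vector_transpose_matrix transpose_transpose)
  have "inj ((*v) (transpose V))"
    using assms(1) by (simp add: rank_transpose flip: full_rank_injective)
  then have "x = 0" if "?M *v x = 0" for x
    using dot[of x x] that by (metis inj_onD inner_eq_zero_iff inner_zero_right iso_tuple_UNIV_I matrix_vector_mult_0_right)
  then have "invertible ?M"
    using matrix_left_invertible_ker invertible_left_inverse by blast
  then show MN: "?M ** N = mat 1"
    unfolding invertible_def matrix_inv_def N_def by (rule someI2_ex) blast
  then have "?M *v (N *v z) = z" for z
    by (simp add: matrix_vector_mul_assoc)
  then show "x \<bullet> (N *v y) = (transpose V *v (N *v x)) \<bullet> (transpose V *v (N *v y))"
    by (metis dot inner_commute)
qed

theorem proposition2p1: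
  fixes V :: "real^'n^'d" and w w' :: "real^'d"
  assumes "rank V = CARD('d)"
    and "unimodular (append_column (append_column V w) w')"
  shows "measure lebesgue (zonotope V)
           * measure lebesgue (zonotope V + closed_segment 0 w + closed_segment 0 w')
         \<le> measure lebesgue (zonotope V + closed_segment 0 w)
           * measure lebesgue (zonotope V + closed_segment 0 w')
       \<and> (measure lebesgue (zonotope V)
             * measure lebesgue (zonotope V + closed_segment 0 w + closed_segment 0 w')
           = measure lebesgue (zonotope V + closed_segment 0 w)
             * measure lebesgue (zonotope V + closed_segment 0 w')
          \<longleftrightarrow> orthogonal w (matrix_inv (V ** transpose V) *v w'))"
proof -
  define M where "M = V ** transpose V"
  define N where "N = matrix_inv M"
  define a where "a = w \<bullet> (N *v w)"
  define b where "b = w' \<bullet> (N *v w')"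
  define c where "c = w \<bullet> (N *v w')"
  have MN: "M ** N = mat 1"
    and N: "x \<bullet> (N *v y) = (transpose V *v (N *v x)) \<bullet> (transpose V *v (N *v y))" for x y
    using mult_transpose_inverse[OF assms(1)] by (simp_all only: M_def N_def)
  \<comment> \<open>As a squared norm, \<open>a\<close> is nonnegative.\<close>
  have "1 + a \<noteq> 0"
    unfolding a_def N[of w w] by (metis add_pos_nonneg inner_ge_zero less_irrefl zero_less_one)
  have c: "w' \<bullet> (N *v w) = c"
    unfolding c_def N by (simp add: inner_commute)
  have "unimodular (append_column V w)"
    by (rule unimodular_reindex[OF assms(2), of Some]) (auto simp: append_column_def)
  \<comment> \<open>The map \<open>map_option Some\<close> keeps the last column \<open>w'\<close>
    (index \<open>None\<close>) and skips \<open>w\<close> (index \<open>Some None\<close>).\<close>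
  moreover have "unimodular (append_column V w')"
    by (rule unimodular_reindex[OF assms(2), of "map_option Some"])
      (auto simp: append_column_def intro: option.inj_map split: option.split)
  moreover have "unimodular V"
    by (rule unimodular_reindex[OF assms(2), of "Some \<circ> Some"])
      (auto simp: append_column_def inj_def)
  moreover have "det (M + outer w w + outer w' w') = det M * ((1 + a) * (1 + b) - c\<^sup>2)"
    using det_add_outer_add_outer[OF MN, of w w'] \<open>1 + a \<noteq> 0\<close>
    by (simp add: a_def[symmetric] b_def[symmetric] c_def[symmetric] c power2_eq_square)
  ultimately have vol: "measure lebesgue (zonotope V) = det M"
    "measure lebesgue (zonotope V + closed_segment 0 w) = det M * (1 + a)"
    "measure lebesgue (zonotope V + closed_segment 0 w') = det M * (1 + b)"
    "measure lebesgue (zonotope V + closed_segment 0 w + closed_segment 0 w')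
      = det M * ((1 + a) * (1 + b) - c\<^sup>2)"
    using assms(2)
    by (simp_all add: measure_zonotope_unimodular append_column_mult_transpose
        det_add_outer[OF MN] flip: zonotope_append_column M_def a_def b_def)
  \<comment> \<open>The gap is a square, which gives the inequality; as \<open>det M\<close> is
    nonzero, it vanishes exactly when \<open>c = 0\<close>.\<close>
  have "(det M * (1 + a)) * (det M * (1 + b)) - det M * (det M * ((1 + a) * (1 + b) - c\<^sup>2))
      = (det M * c)\<^sup>2"
    by (simp add: algebra_simps power2_eq_square)
  moreover have "det M \<noteq> 0"
    using MN invertible_det_nz invertible_right_inverse by blast
  ultimately have "det M * (det M * ((1 + a) * (1 + b) - c\<^sup>2)) \<le> (det M * (1 + a)) * (det M * (1 + b))
      \<and> (det M * (det M * ((1 + a) * (1 + b) - c\<^sup>2)) = (det M * (1 + a)) * (det M * (1 + b)) \<longleftrightarrow> c = 0)"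
    by (smt (verit) mult_eq_0_iff zero_eq_power2 zero_le_power2)
  then show ?thesis
    by (simp only: vol orthogonal_def c_def N_def M_def)
qed

end
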